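(* If $\delta\le\kappa\le\lambda$ are uncountable cardinals with $\delta$ regular and with $\lambda^{<\delta}=\lambda$, and $\kappa$ is $(\delta,\lambda)$-strongly compact, then $\kappa$ is $(\delta,\lambda)$-compact.
   Context: Work in ZFC. Compactness. $\mathcal L_{\delta,\omega}$ denotes the logic extending first-order logic by allowing conjunctions and disjunctions of arbitrary size less than $\delta$, with formulas using only finitely many free variables. For uncountable cardinals $\delta\le\kappa\le\lambda$ with $\delta$ regular, $\kappa$ is $(\delta,\lambda)$-compact if every $\mathcal L_{\delta,\omega}$-theory in a language of size at most $\lambda$, all of whose subsets of size less than $\kappa$ have a model, has a model. Strong compactness. $\mathcal P_\kappa(\lambda)$ is the collection of subsets of $\lambda$ of cardinality less than $\kappa$. For uncountable cardinals $\delta\le\kappa\le\lambda$, $\kappa$ is $(\delta,\lambda)$-strongly compact if there is a fine, ${<}\delta$-complete ultrafilter $U$ on $\mathcal P(\mathcal P_\kappa(\lambda))$, i.e. $U\subseteq\mathcal P(\mathcal P_\kappa(\lambda))$ such that: $\mathcal P_\kappa(\lambda)\in U$, $\emptyset\notin U$; $U$ is closed under supersets; every family of fewer than $\delta$ many elements of $U$ has nonempty intersection; for every $Y\subseteq\mathcal P_\kappa(\lambda)$, $Y\in U$ or $\mathcal P_\kappa(\lambda)\setminus Y\in U$; and (fineness) $\{x\in\mathcal P_\kappa(\lambda)\mid\gamma\in x\}\in U$ for every $\gamma<\lambda$. *)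

theory Defs
  imports Main
begin

unbundle cardinal_syntax

text \<open>
  Cardinals are the cardinal well-orders of the library (\<^const>\<open>Card_order\<close>). The ordinals below
  the cardinal \<open>r\<close> are the elements of \<open>Field r\<close>, where \<open>a\<close> stands for its initial segment
  \<open>underS r a\<close>.
\<close>

definition uncountable_cardinal :: "'a rel \<Rightarrow> bool" where
  "uncountable_cardinal r \<longleftrightarrow> Card_order r \<and> natLeq <o r"

text \<open>The cardinal \<open>r\<^sup><\<^sup>s\<close>: the number of sequences in \<open>r\<close> whose length is an ordinal below \<open>s\<close>.\<close>

definition weak_power :: "'a rel \<Rightarrow> 'b rel \<Rightarrow> ('b \<times> ('b \<Rightarrow> 'a)) rel" where
  "weak_power r s = |SIGMA a : Field s. Func (underS s a) (Field r)|"


subsection \<open>Strong compactness\<close>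

definition Pow_less :: "'k rel \<Rightarrow> 'l rel \<Rightarrow> 'l set set" where
  "Pow_less \<kappa> lam = {x. x \<subseteq> Field lam \<and> |x| <o \<kappa>}"

definition fine_complete_ultrafilter ::
    "'d rel \<Rightarrow> 'k rel \<Rightarrow> 'l rel \<Rightarrow> 'l set set set \<Rightarrow> bool" where
  "fine_complete_ultrafilter \<delta> \<kappa> lam U \<longleftrightarrow>
     U \<subseteq> Pow (Pow_less \<kappa> lam) \<and>
     Pow_less \<kappa> lam \<in> U \<and> {} \<notin> U \<and>
     (\<forall>X Y. X \<in> U \<and> X \<subseteq> Y \<and> Y \<subseteq> Pow_less \<kappa> lam \<longrightarrow> Y \<in> U) \<and>
     (\<forall>F \<subseteq> U. |F| <o \<delta> \<longrightarrow> \<Inter>F \<noteq> {}) \<and>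
     (\<forall>Y \<subseteq> Pow_less \<kappa> lam. Y \<in> U \<or> Pow_less \<kappa> lam - Y \<in> U) \<and>
     (\<forall>\<gamma> \<in> Field lam. {x \<in> Pow_less \<kappa> lam. \<gamma> \<in> x} \<in> U)"

definition strongly_compact_cardinal :: "'d rel \<Rightarrow> 'k rel \<Rightarrow> 'l rel \<Rightarrow> bool" where
  "strongly_compact_cardinal \<delta> \<kappa> lam \<longleftrightarrow> (\<exists>U. fine_complete_ultrafilter \<delta> \<kappa> lam U)"


subsection \<open>The logic \<open>\<L>\<^sub>\<delta>\<^sub>\<omega>\<close>\<close>

record ('f, 'r) language =
  funs :: "'f set"
  rels :: "'r set"
  fun_arity :: "'f \<Rightarrow> nat"
  rel_arity :: "'r \<Rightarrow> nat"

datatype 'f tm = Var nat | Fn 'f "'f tm list"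

text \<open>
  Conjunctions and disjunctions are taken over families of formulas, given as partial functions on
  an index type \<open>'d\<close>. Below, \<open>'d\<close> is the type underlying the cardinal \<open>\<delta>\<close>, and the index sets are
  the subsets of \<open>\<delta>\<close> of size less than \<open>\<delta>\<close>; every set of fewer than \<open>\<delta>\<close> formulas is the range of
  such a family. Finite conjunctions and disjunctions are included.
\<close>

datatype ('f, 'r, 'd) fm =
    Eq "'f tm" "'f tm"
  | Rel 'r "'f tm list"
  | Neg "('f, 'r, 'd) fm"
  | Conj "'d \<Rightarrow> ('f, 'r, 'd) fm option"
  | Disj "'d \<Rightarrow> ('f, 'r, 'd) fm option"
  | Forall nat "('f, 'r, 'd) fm"
  | Exists nat "('f, 'r, 'd) fm"

primrec fv_tm :: "'f tm \<Rightarrow> nat set" where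
  "fv_tm (Var x) = {x}"
| "fv_tm (Fn f ts) = \<Union>(set (map fv_tm ts))"

primrec fv :: "('f, 'r, 'd) fm \<Rightarrow> nat set" where
  "fv (Eq s t) = fv_tm s \<union> fv_tm t"
| "fv (Rel r ts) = \<Union>(set (map fv_tm ts))"
| "fv (Neg \<phi>) = fv \<phi>"
| "fv (Conj \<Phi>) = \<Union>(ran (\<lambda>i. map_option fv (\<Phi> i)))"
| "fv (Disj \<Phi>) = \<Union>(ran (\<lambda>i. map_option fv (\<Phi> i)))"
| "fv (Forall x \<phi>) = fv \<phi> - {x}"
| "fv (Exists x \<phi>) = fv \<phi> - {x}"

inductive_set terms :: "('f, 'r) language \<Rightarrow> 'f tm set" for L where
  "Var x \<in> terms L"
| "f \<in> funs L \<Longrightarrow> length ts = fun_arity L f \<Longrightarrow> \<forall>t \<in> set ts. t \<in> terms L \<Longrightarrow> Fn f ts \<in> terms L"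

inductive_set formulas :: "'d rel \<Rightarrow> ('f, 'r) language \<Rightarrow> ('f, 'r, 'd) fm set" for \<delta> L where
  "s \<in> terms L \<Longrightarrow> t \<in> terms L \<Longrightarrow> Eq s t \<in> formulas \<delta> L"
| "r \<in> rels L \<Longrightarrow> length ts = rel_arity L r \<Longrightarrow> set ts \<subseteq> terms L \<Longrightarrow> Rel r ts \<in> formulas \<delta> L"
| "\<phi> \<in> formulas \<delta> L \<Longrightarrow> Neg \<phi> \<in> formulas \<delta> L"
| "dom \<Phi> \<subseteq> Field \<delta> \<Longrightarrow> |dom \<Phi>| <o \<delta> \<Longrightarrow> \<forall>\<phi> \<in> ran \<Phi>. \<phi> \<in> formulas \<delta> L \<Longrightarrow>
     finite (fv (Conj \<Phi>)) \<Longrightarrow> Conj \<Phi> \<in> formulas \<delta> L"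
| "dom \<Phi> \<subseteq> Field \<delta> \<Longrightarrow> |dom \<Phi>| <o \<delta> \<Longrightarrow> \<forall>\<phi> \<in> ran \<Phi>. \<phi> \<in> formulas \<delta> L \<Longrightarrow>
     finite (fv (Disj \<Phi>)) \<Longrightarrow> Disj \<Phi> \<in> formulas \<delta> L"
| "\<phi> \<in> formulas \<delta> L \<Longrightarrow> Forall x \<phi> \<in> formulas \<delta> L"
| "\<phi> \<in> formulas \<delta> L \<Longrightarrow> Exists x \<phi> \<in> formulas \<delta> L"

definition sentences :: "'d rel \<Rightarrow> ('f, 'r) language \<Rightarrow> ('f, 'r, 'd) fm set" where
  "sentences \<delta> L = {\<phi> \<in> formulas \<delta> L. fv \<phi> = {}}"

record ('f, 'r, 'm) struct =
  univ :: "'m set"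
  fun_interp :: "'f \<Rightarrow> 'm list \<Rightarrow> 'm"
  rel_interp :: "'r \<Rightarrow> 'm list \<Rightarrow> bool"

definition is_structure :: "('f, 'r) language \<Rightarrow> ('f, 'r, 'm) struct \<Rightarrow> bool" where
  "is_structure L M \<longleftrightarrow> univ M \<noteq> {} \<and>
     (\<forall>f \<in> funs L. \<forall>xs. length xs = fun_arity L f \<and> set xs \<subseteq> univ M \<longrightarrow> fun_interp M f xs \<in> univ M)"

primrec tm_val :: "('f, 'r, 'm) struct \<Rightarrow> (nat \<Rightarrow> 'm) \<Rightarrow> 'f tm \<Rightarrow> 'm" where
  "tm_val M v (Var x) = v x"
| "tm_val M v (Fn f ts) = fun_interp M f (map (tm_val M v) ts)"

primrec sat :: "('f, 'r, 'm) struct \<Rightarrow> ('f, 'r, 'd) fm \<Rightarrow> (nat \<Rightarrow> 'm) \<Rightarrow> bool" where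
  "sat M (Eq s t) = (\<lambda>v. tm_val M v s = tm_val M v t)"
| "sat M (Rel r ts) = (\<lambda>v. rel_interp M r (map (tm_val M v) ts))"
| "sat M (Neg \<phi>) = (\<lambda>v. \<not> sat M \<phi> v)"
| "sat M (Conj \<Phi>) = (\<lambda>v. \<forall>S \<in> ran (\<lambda>i. map_option (sat M) (\<Phi> i)). S v)"
| "sat M (Disj \<Phi>) = (\<lambda>v. \<exists>S \<in> ran (\<lambda>i. map_option (sat M) (\<Phi> i)). S v)"
| "sat M (Forall x \<phi>) = (\<lambda>v. \<forall>a \<in> univ M. sat M \<phi> (v(x := a)))"
| "sat M (Exists x \<phi>) = (\<lambda>v. \<exists>a \<in> univ M. sat M \<phi> (v(x := a)))"

lemma fv_Conj_Disj:
  "fv (Conj \<Phi>) = (\<Union>\<phi> \<in> ran \<Phi>. fv \<phi>)"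
  "fv (Disj \<Phi>) = (\<Union>\<phi> \<in> ran \<Phi>. fv \<phi>)"
  by (auto simp: ran_def)

lemma sat_Conj_Disj:
  "sat M (Conj \<Phi>) v \<longleftrightarrow> (\<forall>\<phi> \<in> ran \<Phi>. sat M \<phi> v)"
  "sat M (Disj \<Phi>) v \<longleftrightarrow> (\<exists>\<phi> \<in> ran \<Phi>. sat M \<phi> v)"
  by (auto simp: ran_def)

text \<open>
  \<open>has_model TYPE('m) L T\<close>: the theory \<open>T\<close> has a model whose universe is a nonempty set of elements
  of \<open>'m\<close>.
\<close>

definition models :: "('f, 'r, 'm) struct \<Rightarrow> ('f, 'r, 'd) fm set \<Rightarrow> bool" where
  "models M T \<longleftrightarrow> (\<forall>\<phi> \<in> T. \<forall>v. range v \<subseteq> univ M \<longrightarrow> sat M \<phi> v)"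

definition has_model ::
    "'m itself \<Rightarrow> ('f, 'r) language \<Rightarrow> ('f, 'r, 'd) fm set \<Rightarrow> bool" where
  "has_model _ L T \<longleftrightarrow> (\<exists>M :: ('f, 'r, 'm) struct. is_structure L M \<and> models M T)"


subsection \<open>Compactness\<close>

text \<open>
  Types cannot be quantified inside a formula, so the types of the function symbols \<open>'f\<close>, of the
  relation symbols \<open>'r\<close>, of the elements of the models of the small subtheories \<open>'n\<close>, and of the
  elements of the model of the whole theory \<open>'m\<close>, are parameters. The first three are meant to be
  arbitrary, so that a statement about all of them covers all languages and all models of the
  small subtheories. The last is a bound for the existential claim ``has a model'', and is meant
  to be any type with at least \<open>lam\<close> elements: a type with fewer elements could fail to contain
  a model of a satisfiable theory.
\<close>

definition compact_cardinal ::
    "'f itself \<Rightarrow> 'r itself \<Rightarrow> 'n itself \<Rightarrow> 'm itself \<Rightarrow> 'd rel \<Rightarrow> 'k rel \<Rightarrow> 'l rel \<Rightarrow> bool" where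
  "compact_cardinal _ _ _ _ \<delta> \<kappa> lam \<longleftrightarrow>
     (\<forall>(L :: ('f, 'r) language) T.
        |funs L <+> rels L| \<le>o lam \<and> T \<subseteq> sentences \<delta> L \<and>
        (\<forall>T0 \<subseteq> T. |T0| <o \<kappa> \<longrightarrow> has_model TYPE('n) L T0) \<longrightarrow>
        has_model TYPE('m) L T)"

end

theory Submission
  imports Defs
begin

text \<open>
  Since \<open>\<delta>\<close> is regular and \<open>\<lambda>\<^sup><\<^sup>\<delta> = \<lambda>\<close>, a language of size at most \<open>\<lambda>\<close> has at most \<open>\<lambda>\<close> formulas
  (\<open>card_formulas\<close>).
  Hence a theory \<open>T\<close> injects into \<open>\<lambda>\<close> by some \<open>g\<close>, and each \<open>x \<in> P\<^sub>\<kappa>(\<lambda>)\<close> determines a subtheory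
  \<open>{\<phi> \<in> T. g \<phi> \<in> x}\<close> of size less than \<open>\<kappa>\<close>, which has a model \<open>M x\<close>. By fineness, every \<open>\<phi> \<in> T\<close> holds
  in \<open>M x\<close> for almost all \<open>x\<close> with respect to the ultrafilter, and \<open>\<delta>\<close>-completeness lets the proof of
  Los's theorem pass through conjunctions and disjunctions of size less than \<open>\<delta>\<close>. So \<open>T\<close> holds in the
  ultraproduct of the \<open>M x\<close>.

  That ultraproduct is in general much larger than \<open>\<lambda>\<close>, while a model on a type of which only
  the lower bound \<open>\<lambda>\<close> on its size is known is sought, so a downward Loewenheim-Skolem argument is needed as well. Both
  steps are done at once: \<open>L\<close> is expanded by a Skolem function for each formula and variable, all
  \<open>M x\<close> are expanded accordingly, and the model is the set of Skolem terms modulo the relation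
  that two terms have the same value in almost all \<open>M x\<close>. This is, inside the
  ultraproduct, the Skolem hull of the class of a choice of one element from each \<open>M x\<close>. It has at most \<open>\<lambda>\<close>
  elements because there are at most \<open>\<lambda>\<close> Skolem terms (\<open>card_skolem_terms\<close>), and
  Los's theorem holds for it (\<open>Los_Skolem_terms\<close>) because witnesses for existential formulas are
  themselves values of Skolem terms.
\<close>

section \<open>Counting terms and formulas\<close>

text \<open>
  The common source of all codes below: a single injection that codes a constructor, as a number,
  together with the list of the codes of its arguments.
\<close>

lemma tagged_lists_inject:
  fixes A :: "'a set"
  assumes "infinite A"
  obtains k :: "nat \<Rightarrow> 'a list \<Rightarrow> 'a"
  where "\<And>i xs. set xs \<subseteq> A \<Longrightarrow> k i xs \<in> A"
    and "\<And>i j xs ys. set xs \<subseteq> A \<Longrightarrow> set ys \<subseteq> A \<Longrightarrow> k i xs = k j ys \<Longrightarrow> i = j \<and> xs = ys"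
proof -
  obtain j :: "nat \<Rightarrow> 'a" where j: "inj j" "range j \<subseteq> A"
    using assms infinite_iff_countable_subset[of A] by auto
  have "|A \<times> A| \<le>o |A|"
    using card_of_Times_same_infinite[OF assms] ordIso_imp_ordLeq by blast
  then obtain h where h: "inj_on h (A \<times> A)" "h ` (A \<times> A) \<subseteq> A"
    using card_of_ordLeq[of "A \<times> A" A] by blast
  have hA: "h (x, y) \<in> A" if "x \<in> A" "y \<in> A" for x y
    using h(2) that by blast
  have heq: "x = x' \<and> y = y'" if "h (x, y) = h (x', y')" "x \<in> A" "y \<in> A" "x' \<in> A" "y' \<in> A" for x y x' y'
    using inj_onD[OF h(1) that(1)] that by simp
  have jA: "j i \<in> A" for i
    using j(2) by blast
  \<comment> \<open>Iterated pairing is injective only among lists of equal length, so \<open>k\<close> also records the length.\<close>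
  define enc where "enc = (\<lambda>xs. foldr (\<lambda>x c. h (x, c)) xs (j 0))"
  have encA: "enc xs \<in> A" if "set xs \<subseteq> A" for xs
    using that by (induction xs) (auto simp: enc_def jA hA)
  have enc_eq: "xs = ys"
    if "length xs = length ys" "set xs \<subseteq> A" "set ys \<subseteq> A" "enc xs = enc ys" for xs ys
    using that
  proof (induction xs ys rule: list_induct2)
    case (Cons x xs y ys)
    then have "h (x, enc xs) = h (y, enc ys)"
      by (simp add: enc_def)
    with Cons show ?case
      using heq[of x "enc xs" y "enc ys"] encA by auto
  qed simp
  define k where "k = (\<lambda>i xs. h (j i, h (j (length xs), enc xs)))"
  show ?thesis
  proof (rule that[of k])
    show "k i xs \<in> A" if "set xs \<subseteq> A" for i xs
      using that by (simp add: k_def hA jA encA)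
  next
    fix i i' xs ys
    assume xs: "set xs \<subseteq> A" and ys: "set ys \<subseteq> A" and eq: "k i xs = k i' ys"
    have 1: "j i = j i' \<and> h (j (length xs), enc xs) = h (j (length ys), enc ys)"
      using eq unfolding k_def by (rule heq) (simp_all add: hA jA encA xs ys)
    then have 2: "j (length xs) = j (length ys) \<and> enc xs = enc ys"
      using heq jA encA xs ys by blast
    show "i = i' \<and> xs = ys"
      using 1 2 j(1) enc_eq[OF _ xs ys] by (auto dest: injD)
  qed
qed

text \<open>
  The empty list marks the variables, so \<open>k 0\<close> with a nonempty list is free for applications.
\<close>

primrec tm_code :: "(nat \<Rightarrow> 'a list \<Rightarrow> 'a) \<Rightarrow> ('f \<Rightarrow> 'a) \<Rightarrow> 'f tm \<Rightarrow> 'a" where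
  "tm_code k c (Var x) = k x []"
| "tm_code k c (Fn f ts) = k 0 (c f # map (tm_code k c) ts)"

lemma card_terms:
  fixes L :: "('f, 'r) language" and A :: "'a set"
  assumes "infinite A" and "|funs L| \<le>o |A|"
  shows "|terms L| \<le>o |A|"
proof -
  obtain k :: "nat \<Rightarrow> 'a list \<Rightarrow> 'a"
    where kA: "\<And>i xs. set xs \<subseteq> A \<Longrightarrow> k i xs \<in> A"
    and keq: "\<And>i j xs ys. set xs \<subseteq> A \<Longrightarrow> set ys \<subseteq> A \<Longrightarrow> k i xs = k j ys \<Longrightarrow> i = j \<and> xs = ys"
    using tagged_lists_inject[OF assms(1)] by metis
  obtain c where c: "inj_on c (funs L)" "c ` funs L \<subseteq> A"
    using assms(2) card_of_ordLeq[of "funs L" A] by blast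
  have codeA: "tm_code k c t \<in> A" if "t \<in> terms L" for t
    using that by induction (use c(2)[unfolded image_subset_iff] in \<open>auto intro!: kA\<close>)
  have argsA: "set (c f # map (tm_code k c) ts) \<subseteq> A"
    if "f \<in> funs L" "\<forall>t \<in> set ts. t \<in> terms L" for f ts
    using that c(2)[unfolded image_subset_iff] codeA by auto
  have "\<forall>t. t \<in> terms L \<longrightarrow> tm_code k c s = tm_code k c t \<longrightarrow> s = t" if "s \<in> terms L" for s
    using that
  proof induction
    case (1 x)
    show ?case
    proof (intro allI impI)
      fix t assume "t \<in> terms L" and eq: "tm_code k c (Var x) = tm_code k c t"
      then show "Var x = t"
      proof cases
        case (1 y)
        then show ?thesis using keq[of "[]" "[]" x y] eq by simp
      next
        case (2 g ts)
        then show ?thesis using keq[of "[]" "c g # map (tm_code k c) ts" x 0] argsA[of g ts] eq by simp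
      qed
    qed
  next
    case (2 f ss)
    note hyp = 2
    have ssA: "set (c f # map (tm_code k c) ss) \<subseteq> A"
      by (rule argsA) (use 2 in auto)
    show ?case
    proof (intro allI impI)
      fix t assume "t \<in> terms L" and eq: "tm_code k c (Fn f ss) = tm_code k c t"
      then show "Fn f ss = t"
      proof cases
        case (1 y)
        then show ?thesis using keq[OF ssA, of "[]" 0 y] eq by simp
      next
        case (2 g ts)
        have *: "c f = c g \<and> map (tm_code k c) ss = map (tm_code k c) ts"
          using keq[OF ssA argsA, of g ts 0 0] 2 eq by simp
        then have "f = g"
          using c(1) \<open>f \<in> funs L\<close> 2 by (auto dest: inj_onD)
        moreover have "ss = ts"
        proof (rule nth_equalityI)
          show len: "length ss = length ts"
            using * map_eq_imp_length_eq by blast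
          show "ss ! i = ts ! i" if "i < length ss" for i
            using hyp 2(4) that len * by (metis nth_map nth_mem)
        qed
        ultimately show ?thesis using 2 by simp
      qed
    qed
  qed
  then have "inj_on (tm_code k c) (terms L)"
    by (auto intro: inj_onI)
  with codeA show ?thesis
    using card_of_ordLeq[of "terms L" A] by blast
qed

text \<open>
  This is where regularity enters: the domain of such a map has size less than \<open>\<delta>\<close>, hence is
  bounded by some \<open>a < \<delta>\<close>, and the map extends to a total function on \<open>a\<close> if the value None is
  coded by an element of \<open>A\<close>.
\<close>

lemma small_partial_maps:
  fixes \<delta> :: "'d rel" and A :: "'a set"
  assumes \<delta>: "Card_order \<delta>" "infinite (Field \<delta>)" "regularCard \<delta>"
    and A: "infinite A" "|SIGMA a : Field \<delta>. Func (underS \<delta> a) A| \<le>o |A|"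
  shows "|{m :: 'd \<Rightarrow> 'a option. dom m \<subseteq> Field \<delta> \<and> |dom m| <o \<delta> \<and> ran m \<subseteq> A}| \<le>o |A|"
    (is "|?P| \<le>o _")
proof -
  have wo: "wo_rel \<delta>"
    using \<delta>(1) by (simp add: wo_rel_def card_order_on_well_order_on)
  have "\<exists>a \<in> Field \<delta>. dom m \<subseteq> underS \<delta> a" if "m \<in> ?P" for m
  proof -
    have "\<not> cofinal (dom m) \<delta>"
      using that \<delta>(3) not_ordLess_ordIso unfolding regularCard_def by blast
    then obtain a where a: "a \<in> Field \<delta>" "\<And>b. b \<in> dom m \<Longrightarrow> a = b \<or> (a, b) \<notin> \<delta>"
      unfolding cofinal_def by blast
    \<comment> \<open>Not being cofinal only gives a weak upper bound; any larger element is a strict one.\<close>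
    obtain a' where a': "a' \<in> Field \<delta>" "a \<noteq> a'" "(a, a') \<in> \<delta>"
      using infinite_Card_order_limit[OF \<delta>(1,2) a(1)] by blast
    have "b \<in> underS \<delta> a'" if "b \<in> dom m" for b
    proof -
      have "b \<in> Field \<delta>"
        using that \<open>m \<in> ?P\<close> by blast
      then have "(b, a) \<in> \<delta>"
        using a that wo_rel.in_notinI[OF wo] by metis
      with a' show ?thesis
        using transD[OF wo_rel.TRANS[OF wo]] antisymD[OF wo_rel.ANTISYM[OF wo]]
        unfolding underS_def by blast
    qed
    with a'(1) show ?thesis by blast
  qed
  then have "\<forall>m \<in> ?P. \<exists>a. a \<in> Field \<delta> \<and> dom m \<subseteq> underS \<delta> a"
    by blast
  from bchoice[OF this] obtain b
    where b: "\<And>m. m \<in> ?P \<Longrightarrow> b m \<in> Field \<delta> \<and> dom m \<subseteq> underS \<delta> (b m)"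
    by blast
  obtain k :: "nat \<Rightarrow> 'a list \<Rightarrow> 'a"
    where kA: "\<And>i xs. set xs \<subseteq> A \<Longrightarrow> k i xs \<in> A"
    and keq: "\<And>i j xs ys. set xs \<subseteq> A \<Longrightarrow> set ys \<subseteq> A \<Longrightarrow> k i xs = k j ys \<Longrightarrow> i = j \<and> xs = ys"
    using tagged_lists_inject[OF A(1)] by metis
  define opt where "opt = (\<lambda>y. case y of None \<Rightarrow> k 0 [] | Some a \<Rightarrow> k 0 [a])"
  have optA: "opt y \<in> A" if "set_option y \<subseteq> A" for y
    using that by (auto simp: opt_def kA split: option.split)
  have opt_eq: "y = z" if "opt y = opt z" "set_option y \<subseteq> A" "set_option z \<subseteq> A" for y z
    using that by (auto simp: opt_def dest!: keq[rotated 2] split: option.splits)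
  have ranA: "set_option (m i) \<subseteq> A" if "m \<in> ?P" for m i
    using that by (auto simp: ran_def)
  define F where "F = (\<lambda>m. (b m, \<lambda>i. if i \<in> underS \<delta> (b m) then opt (m i) else undefined))"
  have "inj_on F ?P"
  proof (rule inj_onI)
    fix m m' assume m: "m \<in> ?P" and m': "m' \<in> ?P" and eq: "F m = F m'"
    show "m = m'"
    proof
      fix i
      have bb: "b m = b m'"
        using eq by (simp add: F_def)
      show "m i = m' i"
      proof (cases "i \<in> underS \<delta> (b m)")
        case True
        have "opt (m i) = opt (m' i)"
          using eq True bb unfolding F_def by (auto dest!: fun_cong[of _ _ i])
        then show ?thesis
          using opt_eq ranA[OF m] ranA[OF m'] by blast
      next
        case False
        then have "i \<notin> dom m" "i \<notin> dom m'"
          using b[OF m] b[OF m'] bb by auto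
        then show ?thesis by (simp add: domIff)
      qed
    qed
  qed
  moreover have "F ` ?P \<subseteq> (SIGMA a : Field \<delta>. Func (underS \<delta> a) A)"
    using b optA ranA unfolding F_def Func_def by auto
  ultimately have "|?P| \<le>o |SIGMA a : Field \<delta>. Func (underS \<delta> a) A|"
    using card_of_ordLeq by blast
  then show ?thesis
    using A(2) by (rule ordLeq_transitive)
qed

text \<open>
  An infinitary conjunction is coded by the code, under an injection \<open>e\<close> of small partial maps,
  of the family of the codes of its conjuncts. This makes the code a plain structural recursion,
  so that counting formulas takes no recursion on their rank.
\<close>

primrec fm_code ::
    "(nat \<Rightarrow> 'a list \<Rightarrow> 'a) \<Rightarrow> (('d \<Rightarrow> 'a option) \<Rightarrow> 'a) \<Rightarrow> ('f tm \<Rightarrow> 'a) \<Rightarrow> ('r \<Rightarrow> 'a) \<Rightarrow>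
      ('f, 'r, 'd) fm \<Rightarrow> 'a" where
  "fm_code k e c d (Eq s t) = k 0 [c s, c t]"
| "fm_code k e c d (Rel r ts) = k 1 (d r # map c ts)"
| "fm_code k e c d (Neg \<phi>) = k 2 [fm_code k e c d \<phi>]"
| "fm_code k e c d (Conj \<Phi>) = k 3 [e (\<lambda>i. map_option (fm_code k e c d) (\<Phi> i))]"
| "fm_code k e c d (Disj \<Phi>) = k 4 [e (\<lambda>i. map_option (fm_code k e c d) (\<Phi> i))]"
| "fm_code k e c d (Forall x \<phi>) = k (2 * x + 5) [fm_code k e c d \<phi>]"
| "fm_code k e c d (Exists x \<phi>) = k (2 * x + 6) [fm_code k e c d \<phi>]"

text \<open>
  Each constructor contributes a distinct tag, so two formulas with the same code have the same
  constructor and arguments with the same codes.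
\<close>

lemma card_formulas:
  fixes L :: "('f, 'r) language" and \<delta> :: "'d rel" and A :: "'a set"
  assumes \<delta>: "Card_order \<delta>" "infinite (Field \<delta>)" "regularCard \<delta>"
    and A: "infinite A" "|SIGMA a : Field \<delta>. Func (underS \<delta> a) A| \<le>o |A|"
    and L: "|funs L| \<le>o |A|" "|rels L| \<le>o |A|"
  shows "|formulas \<delta> L| \<le>o |A|"
proof -
  obtain k :: "nat \<Rightarrow> 'a list \<Rightarrow> 'a"
    where kA: "\<And>i xs. set xs \<subseteq> A \<Longrightarrow> k i xs \<in> A"
    and keq: "\<And>i j xs ys. set xs \<subseteq> A \<Longrightarrow> set ys \<subseteq> A \<Longrightarrow> k i xs = k j ys \<Longrightarrow> i = j \<and> xs = ys"
    using tagged_lists_inject[OF A(1)] by metis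
  obtain c where c: "inj_on c (terms L)" "c ` terms L \<subseteq> A"
    using card_terms[OF A(1) L(1)] card_of_ordLeq[of "terms L" A] by blast
  obtain d where d: "inj_on d (rels L)" "d ` rels L \<subseteq> A"
    using L(2) card_of_ordLeq[of "rels L" A] by blast
  define P where "P = {m :: 'd \<Rightarrow> 'a option. dom m \<subseteq> Field \<delta> \<and> |dom m| <o \<delta> \<and> ran m \<subseteq> A}"
  obtain e where e: "inj_on e P" "e ` P \<subseteq> A"
    using small_partial_maps[OF \<delta> A] card_of_ordLeq[of P A] unfolding P_def by blast
  let ?c = "fm_code k e c d :: ('f, 'r, 'd) fm \<Rightarrow> 'a"
  have famP: "(\<lambda>i. map_option ?c (\<Phi> i)) \<in> P"
    if "dom \<Phi> \<subseteq> Field \<delta>" "|dom \<Phi>| <o \<delta>" "\<forall>\<phi> \<in> ran \<Phi>. ?c \<phi> \<in> A" for \<Phi>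
  proof -
    have "dom (\<lambda>i. map_option ?c (\<Phi> i)) = dom \<Phi>"
      by (auto simp: dom_def)
    then show ?thesis
      using that by (auto simp: P_def ran_def)
  qed
  have termsA: "c t \<in> A" if "set ts \<subseteq> terms L" "t \<in> set ts" for t ts
    using that c(2) by blast
  have codeA: "?c \<phi> \<in> A" if "\<phi> \<in> formulas \<delta> L" for \<phi>
    using that
  proof induction
    case (2 r ts)
    then show ?case using d(2)[unfolded image_subset_iff] termsA[of ts] by (auto intro!: kA)
  next
    case (4 \<Phi>)
    then show ?case using famP[of \<Phi>] e(2) by (auto intro!: kA)
  next
    case (5 \<Phi>)
    then show ?case using famP[of \<Phi>] e(2) by (auto intro!: kA)
  qed (use c(2)[unfolded image_subset_iff] d(2)[unfolded image_subset_iff] in \<open>auto intro!: kA\<close>)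
  have fam_eq: "\<Phi> = \<Psi>"
    if \<Phi>: "dom \<Phi> \<subseteq> Field \<delta>" "|dom \<Phi>| <o \<delta>"
        "\<forall>\<phi> \<in> ran \<Phi>. \<phi> \<in> formulas \<delta> L \<and> (\<forall>\<psi>. \<psi> \<in> formulas \<delta> L \<longrightarrow> ?c \<phi> = ?c \<psi> \<longrightarrow> \<phi> = \<psi>)"
      and \<Psi>: "dom \<Psi> \<subseteq> Field \<delta>" "|dom \<Psi>| <o \<delta>" "\<forall>\<psi> \<in> ran \<Psi>. \<psi> \<in> formulas \<delta> L"
      and eq: "e (\<lambda>i. map_option ?c (\<Phi> i)) = e (\<lambda>i. map_option ?c (\<Psi> i))" for \<Phi> \<Psi>
  proof
    fix i
    have "(\<lambda>i. map_option ?c (\<Phi> i)) = (\<lambda>i. map_option ?c (\<Psi> i))"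
      using eq inj_on_eq_iff[OF e(1) famP famP, of \<Phi> \<Psi>] \<Phi> \<Psi> codeA by blast
    then have "map_option ?c (\<Phi> i) = map_option ?c (\<Psi> i)"
      by (rule fun_cong)
    then show "\<Phi> i = \<Psi> i"
      using \<Phi>(3) \<Psi>(3) by (cases "\<Phi> i"; cases "\<Psi> i") (auto simp: ran_def)
  qed
  define tag :: "('f, 'r, 'd) fm \<Rightarrow> nat" where "tag = (\<lambda>\<phi>. case \<phi> of
      Eq _ _ \<Rightarrow> 0 | Rel _ _ \<Rightarrow> 1 | Neg _ \<Rightarrow> 2 | Conj _ \<Rightarrow> 3 | Disj _ \<Rightarrow> 4
    | Forall x _ \<Rightarrow> 2 * x + 5 | Exists x _ \<Rightarrow> 2 * x + 6)"
  define args :: "('f, 'r, 'd) fm \<Rightarrow> 'a list" where "args = (\<lambda>\<phi>. case \<phi> of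
      Eq s t \<Rightarrow> [c s, c t] | Rel r ts \<Rightarrow> d r # map c ts | Neg \<phi> \<Rightarrow> [?c \<phi>]
    | Conj \<Phi> \<Rightarrow> [e (\<lambda>i. map_option ?c (\<Phi> i))] | Disj \<Phi> \<Rightarrow> [e (\<lambda>i. map_option ?c (\<Phi> i))]
    | Forall _ \<phi> \<Rightarrow> [?c \<phi>] | Exists _ \<phi> \<Rightarrow> [?c \<phi>])"
  have parity: "2 * x + 5 \<noteq> 2 * y + 6" "2 * y + 6 \<noteq> 2 * x + 5" for x y :: nat
    by presburger+
  have code: "?c \<phi> = k (tag \<phi>) (args \<phi>)" for \<phi>
    by (cases \<phi>) (simp_all add: tag_def args_def)
  have argsA: "set (args \<phi>) \<subseteq> A" if "\<phi> \<in> formulas \<delta> L" for \<phi>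
    using that
  proof cases
    case (2 r ts)
    then show ?thesis using d(2)[unfolded image_subset_iff] termsA[of ts] by (auto simp: args_def)
  next
    case (4 \<Phi>)
    then show ?thesis using famP[of \<Phi>] codeA e(2) by (auto simp: args_def)
  next
    case (5 \<Phi>)
    then show ?thesis using famP[of \<Phi>] codeA e(2) by (auto simp: args_def)
  qed (use c(2)[unfolded image_subset_iff] d(2)[unfolded image_subset_iff] codeA in \<open>auto simp: args_def\<close>)
  have code_eq: "tag \<phi> = tag \<psi> \<and> args \<phi> = args \<psi>"
    if "\<phi> \<in> formulas \<delta> L" "\<psi> \<in> formulas \<delta> L" "?c \<phi> = ?c \<psi>" for \<phi> \<psi>
    using that argsA keq unfolding code by blast
  have "\<forall>\<psi>. \<psi> \<in> formulas \<delta> L \<longrightarrow> ?c \<phi> = ?c \<psi> \<longrightarrow> \<phi> = \<psi>" if "\<phi> \<in> formulas \<delta> L" for \<phi>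
    using that
  proof induction
    case (1 s t)
    show ?case
    proof (intro allI impI)
      fix \<psi> assume \<psi>: "\<psi> \<in> formulas \<delta> L" and eq: "?c (Eq s t) = ?c \<psi>"
      have same: "tag (Eq s t) = tag \<psi>" "args (Eq s t) = args \<psi>"
        using code_eq[OF _ \<psi> eq] 1 by (auto intro: formulas.intros)
      from \<psi> show "Eq s t = \<psi>"
        by cases (use 1 c(1) same in \<open>auto simp: tag_def args_def dest: inj_onD\<close>)
    qed
  next
    case (2 r ts)
    show ?case
    proof (intro allI impI)
      fix \<psi> assume \<psi>: "\<psi> \<in> formulas \<delta> L" and eq: "?c (Rel r ts) = ?c \<psi>"
      have same: "tag (Rel r ts) = tag \<psi>" "args (Rel r ts) = args \<psi>"
        using code_eq[OF _ \<psi> eq] 2 by (auto intro: formulas.intros)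
      from \<psi> show "Rel r ts = \<psi>"
        by cases (use 2 c(1) d(1) same in \<open>auto simp: tag_def args_def dest: inj_onD
          intro!: map_inj_on[OF _ inj_on_subset[OF c(1)]]\<close>)
    qed
  next
    case (3 \<phi>)
    note hyp = 3
    show ?case
    proof (intro allI impI)
      fix \<psi> assume \<psi>: "\<psi> \<in> formulas \<delta> L" and eq: "?c (Neg \<phi>) = ?c \<psi>"
      have same: "tag (Neg \<phi>) = tag \<psi>" "args (Neg \<phi>) = args \<psi>"
        using code_eq[OF _ \<psi> eq] 3 by (auto intro: formulas.intros)
      from \<psi> show "Neg \<phi> = \<psi>"
      proof cases
        case (3 \<phi>')
        then have "?c \<phi> = ?c \<phi>'"
          using same by (simp add: args_def)
        with hyp(2) 3 show ?thesis by blast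
      qed (use same in \<open>simp_all add: tag_def\<close>)
    qed
  next
    case (4 \<Phi>)
    note hyp = 4
    show ?case
    proof (intro allI impI)
      fix \<psi> assume \<psi>: "\<psi> \<in> formulas \<delta> L" and eq: "?c (Conj \<Phi>) = ?c \<psi>"
      have same: "tag (Conj \<Phi>) = tag \<psi>" "args (Conj \<Phi>) = args \<psi>"
        using code_eq[OF formulas.intros(4) \<psi> eq] 4 by blast+
      from \<psi> show "Conj \<Phi> = \<psi>"
      proof cases
        case (4 \<Psi>)
        then have "e (\<lambda>i. map_option ?c (\<Phi> i)) = e (\<lambda>i. map_option ?c (\<Psi> i))"
          using same by (simp add: args_def)
        then have "\<Phi> = \<Psi>"
          by (intro fam_eq) (use hyp 4 in blast)+
        with 4 show ?thesis by simp
      qed (use same in \<open>simp_all add: tag_def\<close>)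
    qed
  next
    case (5 \<Phi>)
    note hyp = 5
    show ?case
    proof (intro allI impI)
      fix \<psi> assume \<psi>: "\<psi> \<in> formulas \<delta> L" and eq: "?c (Disj \<Phi>) = ?c \<psi>"
      have same: "tag (Disj \<Phi>) = tag \<psi>" "args (Disj \<Phi>) = args \<psi>"
        using code_eq[OF formulas.intros(5) \<psi> eq] 5 by blast+
      from \<psi> show "Disj \<Phi> = \<psi>"
      proof cases
        case (5 \<Psi>)
        then have "e (\<lambda>i. map_option ?c (\<Phi> i)) = e (\<lambda>i. map_option ?c (\<Psi> i))"
          using same by (simp add: args_def)
        then have "\<Phi> = \<Psi>"
          by (intro fam_eq) (use hyp 5 in blast)+
        with 5 show ?thesis by simp
      qed (use same in \<open>simp_all add: tag_def\<close>)
    qed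
  next
    case (6 \<phi> x)
    note hyp = 6
    show ?case
    proof (intro allI impI)
      fix \<psi> assume \<psi>: "\<psi> \<in> formulas \<delta> L" and eq: "?c (Forall x \<phi>) = ?c \<psi>"
      have same: "tag (Forall x \<phi>) = tag \<psi>" "args (Forall x \<phi>) = args \<psi>"
        using code_eq[OF _ \<psi> eq] 6 by (auto intro: formulas.intros)
      from \<psi> show "Forall x \<phi> = \<psi>"
      proof cases
        case (6 \<phi>' y)
        then have "x = y" "?c \<phi> = ?c \<phi>'"
          using same by (simp_all add: tag_def args_def)
        with hyp(2) 6 show ?thesis by blast
      qed (use same parity in \<open>simp_all add: tag_def\<close>)
    qed
  next
    case (7 \<phi> x)
    note hyp = 7
    show ?case
    proof (intro allI impI)
      fix \<psi> assume \<psi>: "\<psi> \<in> formulas \<delta> L" and eq: "?c (Exists x \<phi>) = ?c \<psi>"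
      have same: "tag (Exists x \<phi>) = tag \<psi>" "args (Exists x \<phi>) = args \<psi>"
        using code_eq[OF _ \<psi> eq] 7 by (auto intro: formulas.intros)
      from \<psi> show "Exists x \<phi> = \<psi>"
      proof cases
        case (7 \<phi>' y)
        then have "x = y" "?c \<phi> = ?c \<phi>'"
          using same by (simp_all add: tag_def args_def)
        with hyp(2) 7 show ?thesis by blast
      qed (use same parity in \<open>simp_all add: tag_def\<close>)
    qed
  qed
  then have "inj_on ?c (formulas \<delta> L)"
    by (auto intro: inj_onI)
  with codeA show ?thesis
    using card_of_ordLeq[of "formulas \<delta> L" A] by blast
qed

section \<open>Skolem functions\<close>

lemma finite_fv_tm: "finite (fv_tm t)"
  by (induction t) auto

lemma finite_fv: "\<phi> \<in> formulas \<delta> L \<Longrightarrow> finite (fv \<phi>)"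
  by (induction rule: formulas.induct) (auto simp: finite_fv_tm simp del: fv.simps(4,5))

lemma tm_val_cong: "(\<And>x. x \<in> fv_tm t \<Longrightarrow> v x = w x) \<Longrightarrow> tm_val M v t = tm_val M w t"
proof (induction t)
  case (Fn f ts)
  then have "map (tm_val M v) ts = map (tm_val M w) ts"
    by (intro map_cong) auto
  then show ?case by (simp only: tm_val.simps)
qed simp

lemma sat_cong: "(\<And>x. x \<in> fv \<phi> \<Longrightarrow> v x = w x) \<Longrightarrow> sat M \<phi> v \<longleftrightarrow> sat M \<phi> w"
proof (induction \<phi> arbitrary: v w)
  case (Eq s t)
  then show ?case using tm_val_cong[of s v w M] tm_val_cong[of t v w M] by simp
next
  case (Rel r ts)
  then have "map (tm_val M v) ts = map (tm_val M w) ts"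
    by (auto intro: tm_val_cong)
  then show ?case by (simp only: sat.simps)
next
  case (Neg \<phi>)
  have "sat M \<phi> v \<longleftrightarrow> sat M \<phi> w"
    by (rule Neg.IH) (use Neg.prems in simp)
  then show ?case by simp
next
  case (Conj \<Phi>)
  have "sat M \<phi> v \<longleftrightarrow> sat M \<phi> w" if "\<phi> \<in> ran \<Phi>" for \<phi>
  proof (rule Conj.IH)
    show "Some \<phi> \<in> range \<Phi>" "\<phi> \<in> set_option (Some \<phi>)"
      using that by (auto simp: ran_def intro: range_eqI[OF sym])
    show "v x = w x" if "x \<in> fv \<phi>" for x
      using Conj.prems that \<open>\<phi> \<in> ran \<Phi>\<close> unfolding fv_Conj_Disj by blast
  qed
  then show ?case unfolding sat_Conj_Disj by blast
next
  case (Disj \<Phi>)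
  have "sat M \<phi> v \<longleftrightarrow> sat M \<phi> w" if "\<phi> \<in> ran \<Phi>" for \<phi>
  proof (rule Disj.IH)
    show "Some \<phi> \<in> range \<Phi>" "\<phi> \<in> set_option (Some \<phi>)"
      using that by (auto simp: ran_def intro: range_eqI[OF sym])
    show "v x = w x" if "x \<in> fv \<phi>" for x
      using Disj.prems that \<open>\<phi> \<in> ran \<Phi>\<close> unfolding fv_Conj_Disj by blast
  qed
  then show ?case unfolding sat_Conj_Disj by blast
next
  case (Forall x \<phi>)
  have "sat M \<phi> (v(x := a)) \<longleftrightarrow> sat M \<phi> (w(x := a))" for a
    by (rule Forall.IH) (use Forall.prems in auto)
  then show ?case by simp
next
  case (Exists x \<phi>)
  have "sat M \<phi> (v(x := a)) \<longleftrightarrow> sat M \<phi> (w(x := a))" for a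
    by (rule Exists.IH) (use Exists.prems in auto)
  then show ?case by simp
qed

lemma models_sentence:
  assumes "is_structure L M" and "\<phi> \<in> sentences \<delta> L"
  shows "models M {\<phi>} \<longleftrightarrow> sat M \<phi> v"
proof -
  have sat: "sat M \<phi> w \<longleftrightarrow> sat M \<phi> v" for w
    using assms(2) by (intro sat_cong) (simp add: sentences_def)
  obtain a where "a \<in> univ M"
    using assms(1) by (auto simp: is_structure_def)
  then have "range (\<lambda>_ :: nat. a) \<subseteq> univ M" by auto
  then show ?thesis
    unfolding models_def using sat by blast
qed

text \<open>
  \<open>Inr (\<phi>, y)\<close> is the Skolem symbol for \<open>\<exists>y. \<phi>\<close>. A finite arity suffices for it, even if \<open>\<phi>\<close> is
  infinitary, because \<open>\<phi>\<close> has finitely many free variables. Only formulas of \<open>L\<close> itself get Skolem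
  symbols: the model is a model for \<open>L\<close>, so that the expansion need not be iterated.
\<close>

type_synonym ('f, 'r, 'd) skolem_sym = "'f + ('f, 'r, 'd) fm \<times> nat"

definition fv_bound :: "('f, 'r, 'd) fm \<Rightarrow> nat" where
  "fv_bound \<phi> = Suc (Max (insert 0 (fv \<phi>)))"

lemma fv_bound: "\<phi> \<in> formulas \<delta> L \<Longrightarrow> x \<in> fv \<phi> \<Longrightarrow> x < fv_bound \<phi>"
  using finite_fv[of \<phi> \<delta> L] by (auto simp: fv_bound_def less_Suc_eq_le)

definition skolem_language ::
    "'d rel \<Rightarrow> ('f, 'r) language \<Rightarrow> (('f, 'r, 'd) skolem_sym, 'r) language" where
  "skolem_language \<delta> L =
     \<lparr>funs = funs L <+> formulas \<delta> L \<times> UNIV, rels = rels L,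
      fun_arity = case_sum (fun_arity L) (\<lambda>(\<phi>, y). fv_bound \<phi>), rel_arity = rel_arity L\<rparr>"

text \<open>
  If there is no witness, the value is still an element of the universe (if that is nonempty), so that the
  expansion by Skolem functions is a structure.
\<close>

definition witness :: "('f, 'r, 'm) struct \<Rightarrow> ('f, 'r, 'd) fm \<Rightarrow> nat \<Rightarrow> (nat \<Rightarrow> 'm) \<Rightarrow> 'm" where
  "witness M \<phi> y v =
     (SOME a. a \<in> univ M \<and> ((\<exists>b \<in> univ M. sat M \<phi> (v(y := b))) \<longrightarrow> sat M \<phi> (v(y := a))))"

definition skolem_structure ::
    "('f, 'r, 'm) struct \<Rightarrow> (('f, 'r, 'd) skolem_sym, 'r, 'm) struct" where
  "skolem_structure M =
     \<lparr>univ = univ M,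
      fun_interp = case_sum (fun_interp M) (\<lambda>(\<phi>, y) as. witness M \<phi> y (\<lambda>x. as ! x)),
      rel_interp = rel_interp M\<rparr>"

lemma witness:
  assumes "univ M \<noteq> {}"
  shows "witness M \<phi> y v \<in> univ M"
    and "b \<in> univ M \<Longrightarrow> sat M \<phi> (v(y := b)) \<Longrightarrow> sat M \<phi> (v(y := witness M \<phi> y v))"
proof -
  have "\<exists>a. a \<in> univ M \<and> ((\<exists>b \<in> univ M. sat M \<phi> (v(y := b))) \<longrightarrow> sat M \<phi> (v(y := a)))"
    using assms by blast
  from someI_ex[OF this] show "witness M \<phi> y v \<in> univ M"
    and "b \<in> univ M \<Longrightarrow> sat M \<phi> (v(y := b)) \<Longrightarrow> sat M \<phi> (v(y := witness M \<phi> y v))"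
    unfolding witness_def by blast+
qed

text \<open>
  Variables are not eliminated from Skolem terms but read as constants with an arbitrary value;
  this keeps the set of terms nonempty even if \<open>L\<close> has no symbols.
\<close>

definition skolem_val :: "('f, 'r, 'm) struct \<Rightarrow> ('f, 'r, 'd) skolem_sym tm \<Rightarrow> 'm" where
  "skolem_val M = tm_val (skolem_structure M) (\<lambda>_. SOME a. a \<in> univ M)"

lemma skolem_val_Fn [simp]:
  "skolem_val M (Fn (Inl f) ts) = fun_interp M f (map (skolem_val M) ts)"
  "skolem_val M (Fn (Inr (\<phi>, y)) ts) = witness M \<phi> y (\<lambda>x. map (skolem_val M) ts ! x)"
  by (simp_all add: skolem_val_def skolem_structure_def)

lemma skolem_val_in_univ:
  assumes "is_structure L M" and "t \<in> terms (skolem_language \<delta> L)"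
  shows "skolem_val M t \<in> univ M"
  using assms(2)
proof induction
  case (1 x)
  then show ?case
    using assms(1) by (auto simp: skolem_val_def is_structure_def intro: someI)
next
  case (2 g ts)
  show ?case
  proof (cases g)
    case (Inl f)
    with 2 assms(1) show ?thesis
      by (auto simp: is_structure_def skolem_language_def image_subset_iff)
  next
    case (Inr p)
    with assms(1) show ?thesis
      by (cases p) (auto simp: is_structure_def intro: witness)
  qed
qed

definition skolem_term ::
    "('f, 'r, 'd) fm \<Rightarrow> nat \<Rightarrow> (nat \<Rightarrow> ('f, 'r, 'd) skolem_sym tm) \<Rightarrow> ('f, 'r, 'd) skolem_sym tm" where
  "skolem_term \<phi> y w = Fn (Inr (\<phi>, y)) (map w [0..<fv_bound \<phi>])"

lemma skolem_term:
  assumes "\<phi> \<in> formulas \<delta> L" and "range w \<subseteq> terms (skolem_language \<delta> L)"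
  shows "skolem_term \<phi> y w \<in> terms (skolem_language \<delta> L)"
  using assms unfolding skolem_term_def by (intro terms.intros) (auto simp: skolem_language_def)

lemma sat_skolem_term:
  assumes \<phi>: "\<phi> \<in> formulas \<delta> L" and b: "b \<in> univ M" "sat M \<phi> ((\<lambda>x. skolem_val M (w x))(y := b))"
  shows "sat M \<phi> ((\<lambda>x. skolem_val M (w x))(y := skolem_val M (skolem_term \<phi> y w)))"
proof -
  let ?v = "\<lambda>x. skolem_val M (w x)" and ?as = "map (skolem_val M) (map w [0..<fv_bound \<phi>])"
  have cong: "sat M \<phi> (?v(y := a)) \<longleftrightarrow> sat M \<phi> ((\<lambda>x. ?as ! x)(y := a))" for a
    by (rule sat_cong) (use fv_bound[OF \<phi>] in auto)
  have "sat M \<phi> ((\<lambda>x. ?as ! x)(y := witness M \<phi> y (\<lambda>x. ?as ! x)))"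
    using witness(2)[of M b \<phi> "\<lambda>x. ?as ! x" y] b cong by blast
  then show ?thesis
    unfolding cong by (simp add: skolem_term_def)
qed

text \<open>
  The contrapositive form of the Skolem property, used for universal quantifiers: the witness
  for \<open>\<not> \<phi>\<close> is a counterexample to \<open>\<phi>\<close> whenever there is one.
\<close>

lemma sat_skolem_term_Neg:
  assumes \<phi>: "\<phi> \<in> formulas \<delta> L" and b: "b \<in> univ M"
    and sat: "sat M \<phi> ((\<lambda>x. skolem_val M (w x))(y := skolem_val M (skolem_term (Neg \<phi>) y w)))"
  shows "sat M \<phi> ((\<lambda>x. skolem_val M (w x))(y := b))"
  using sat_skolem_term[OF formulas.intros(3)[OF \<phi>] b, of w y] sat
  by (auto simp del: fun_upd_apply)

text \<open>
  An assignment of Skolem terms to variables plays the role of an assignment in the term model;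
  substitution is then the evaluation of terms of \<open>L\<close> there.
\<close>

primrec tm_subst :: "(nat \<Rightarrow> ('f + 's) tm) \<Rightarrow> 'f tm \<Rightarrow> ('f + 's) tm" where
  "tm_subst w (Var x) = w x"
| "tm_subst w (Fn f ts) = Fn (Inl f) (map (tm_subst w) ts)"

lemma tm_subst_terms:
  assumes "range w \<subseteq> terms (skolem_language \<delta> L)" and "t \<in> terms L"
  shows "tm_subst w t \<in> terms (skolem_language \<delta> L)"
  using assms(2)
  by induction (use assms(1) in \<open>auto intro!: terms.intros simp: skolem_language_def\<close>)

lemma skolem_val_subst: "skolem_val M (tm_subst w t) = tm_val M (\<lambda>x. skolem_val M (w x)) t"
  by (induction t) (auto cong: map_cong)

lemma card_skolem_terms:
  fixes L :: "('f, 'r) language" and \<delta> :: "'d rel" and A :: "'a set"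
  assumes \<delta>: "Card_order \<delta>" "infinite (Field \<delta>)" "regularCard \<delta>"
    and A: "infinite A" "|SIGMA a : Field \<delta>. Func (underS \<delta> a) A| \<le>o |A|"
    and L: "|funs L| \<le>o |A|" "|rels L| \<le>o |A|"
  shows "|terms (skolem_language \<delta> L)| \<le>o |A|"
proof (rule card_terms[OF A(1)])
  have "|UNIV :: nat set| \<le>o |A|"
    using A(1) infinite_iff_card_of_nat by blast
  then have "|formulas \<delta> L \<times> (UNIV :: nat set)| \<le>o |A|"
    using card_of_Times_ordLeq_infinite_Field[of "|A|" "formulas \<delta> L" "UNIV :: nat set"] card_formulas[OF assms] A(1)
    by (simp add: Field_card_of card_of_card_order_on)
  then show "|funs (skolem_language \<delta> L)| \<le>o |A|"
    using card_of_Plus_ordLeq_infinite_Field[of "|A|"] L(1) A(1)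
    by (simp add: Field_card_of card_of_card_order_on skolem_language_def)
qed

section \<open>Complete ultrafilters\<close>

locale complete_ultrafilter =
  fixes I :: "'i set" and U :: "'i set set" and \<delta> :: "'d rel"
  assumes \<delta>: "Card_order \<delta>" "infinite (Field \<delta>)"
    and space: "I \<in> U"
    and superset: "X \<in> U \<Longrightarrow> X \<subseteq> Y \<Longrightarrow> Y \<subseteq> I \<Longrightarrow> Y \<in> U"
    and Inter_nonempty: "F \<subseteq> U \<Longrightarrow> |F| <o \<delta> \<Longrightarrow> \<Inter>F \<noteq> {}"
    and ultra: "Y \<subseteq> I \<Longrightarrow> Y \<in> U \<or> I - Y \<in> U"
begin

definition ae :: "('i \<Rightarrow> bool) \<Rightarrow> bool" where
  "ae Q \<longleftrightarrow> {i \<in> I. Q i} \<in> U"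

lemma finite_less: "finite A \<Longrightarrow> |A| <o \<delta>"
  by (rule finite_ordLess_infinite) (use \<delta> in \<open>auto simp: card_of_well_order_on card_order_on_well_order_on Field_card_of\<close>)

lemma insert_less: "|A| <o \<delta> \<Longrightarrow> |insert a A| <o \<delta>"
  using card_of_Un_ordLess_infinite_Field[OF \<delta>(2,1) finite_less[of "{a}"], of A] by simp

lemma ran_less:
  assumes "|dom m| <o \<delta>"
  shows "|ran m| <o \<delta>"
proof -
  have "ran m = (\<lambda>x. the (m x)) ` dom m"
    by (force simp: ran_def dom_def)
  then show ?thesis
    using ordLeq_ordLess_trans[OF card_of_image assms] by simp
qed

lemma ae_mono: "ae Q \<Longrightarrow> (\<And>i. i \<in> I \<Longrightarrow> Q i \<Longrightarrow> R i) \<Longrightarrow> ae R"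
  unfolding ae_def by (erule superset) auto

lemma ae_cong: "(\<And>i. i \<in> I \<Longrightarrow> Q i \<longleftrightarrow> R i) \<Longrightarrow> ae Q \<longleftrightarrow> ae R"
  using ae_mono[of Q R] ae_mono[of R Q] by blast

lemma ae_all: "(\<And>i. i \<in> I \<Longrightarrow> Q i) \<Longrightarrow> ae Q"
  unfolding ae_def by (rule superset[OF space]) auto

text \<open>
  If the intersection of fewer than \<open>\<delta>\<close> sets of \<open>U\<close> were not in \<open>U\<close>, then adding its complement
  would give a family of fewer than \<open>\<delta>\<close> sets of \<open>U\<close> with empty intersection.
\<close>

lemma ae_ball:
  assumes "|J| <o \<delta>"
  shows "ae (\<lambda>i. \<forall>j \<in> J. Q j i) \<longleftrightarrow> (\<forall>j \<in> J. ae (Q j))"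
proof
  assume "ae (\<lambda>i. \<forall>j \<in> J. Q j i)"
  then show "\<forall>j \<in> J. ae (Q j)" by (auto elim: ae_mono)
next
  assume all: "\<forall>j \<in> J. ae (Q j)"
  show "ae (\<lambda>i. \<forall>j \<in> J. Q j i)"
  proof (rule ccontr)
    let ?C = "I - {i \<in> I. \<forall>j \<in> J. Q j i}" and ?F = "(\<lambda>j. {i \<in> I. Q j i}) ` J"
    assume "\<not> ae (\<lambda>i. \<forall>j \<in> J. Q j i)"
    then have "?C \<in> U"
      using ultra[of "{i \<in> I. \<forall>j \<in> J. Q j i}"] unfolding ae_def by blast
    moreover have "?F \<subseteq> U"
      using all unfolding ae_def by blast
    moreover have "|insert ?C ?F| <o \<delta>"
      by (rule insert_less) (rule ordLeq_ordLess_trans[OF card_of_image assms])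
    ultimately have "\<Inter>(insert ?C ?F) \<noteq> {}"
      using Inter_nonempty[of "insert ?C ?F"] by blast
    then show False by auto
  qed
qed

lemma ae_conj: "ae (\<lambda>i. Q i \<and> R i) \<longleftrightarrow> ae Q \<and> ae R"
proof -
  have "ae (\<lambda>i. \<forall>P \<in> {Q, R}. P i) \<longleftrightarrow> (\<forall>P \<in> {Q, R}. ae P)"
    by (rule ae_ball) (simp add: finite_less)
  then show ?thesis by simp
qed

lemma ae_not: "ae (\<lambda>i. \<not> Q i) \<longleftrightarrow> \<not> ae Q"
proof
  assume "ae (\<lambda>i. \<not> Q i)"
  show "\<not> ae Q"
  proof
    assume "ae Q"
    with \<open>ae (\<lambda>i. \<not> Q i)\<close> have "{} \<in> U"
      using ae_conj[of "\<lambda>i. \<not> Q i" Q] by (simp add: ae_def)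
    then show False
      using Inter_nonempty[of "{{}}"] finite_less[of "{{} :: 'i set}"] by simp
  qed
next
  assume "\<not> ae Q"
  moreover have "I - {i \<in> I. Q i} = {i \<in> I. \<not> Q i}" by blast
  ultimately show "ae (\<lambda>i. \<not> Q i)"
    using ultra[of "{i \<in> I. Q i}"] by (auto simp: ae_def)
qed

lemma ae_bex:
  assumes "|J| <o \<delta>"
  shows "ae (\<lambda>i. \<exists>j \<in> J. Q j i) \<longleftrightarrow> (\<exists>j \<in> J. ae (Q j))"
proof -
  have "\<not> ae (\<lambda>i. \<exists>j \<in> J. Q j i) \<longleftrightarrow> ae (\<lambda>i. \<forall>j \<in> J. \<not> Q j i)"
    using ae_not[of "\<lambda>i. \<exists>j \<in> J. Q j i"] by simp
  also have "\<dots> \<longleftrightarrow> (\<forall>j \<in> J. \<not> ae (Q j))"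
    by (simp only: ae_ball[OF assms] ae_not)
  finally show ?thesis by blast
qed

text \<open>
  Los's theorem for the term model, which fits into \<open>'m\<close> if the Skolem terms do. The interpretation
  of function and relation symbols is as in an ultraproduct, on chosen representatives. Atomic
  formulas, connectives and the passage from a term model witness to witnesses in almost all
  \<open>M i\<close> are as usual; in the other direction, witnesses that exist in almost all \<open>M i\<close> are the
  values of one Skolem term, where an ultraproduct would use an arbitrary choice function on \<open>I\<close>.
\<close>

theorem Los_Skolem_terms:
  fixes M :: "'i \<Rightarrow> ('f, 'r, 'n) struct" and L :: "('f, 'r) language"
  assumes structures: "\<And>i. i \<in> I \<Longrightarrow> is_structure L (M i)"
    and room: "|terms (skolem_language \<delta> L)| \<le>o |UNIV :: 'm set|"
  obtains N :: "('f, 'r, 'm) struct" where "is_structure L N"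
    and "\<And>\<phi>. \<phi> \<in> sentences \<delta> L \<Longrightarrow> models N {\<phi>} \<longleftrightarrow> ae (\<lambda>i. models (M i) {\<phi>})"
proof -
  let ?T = "terms (skolem_language \<delta> L)"
  let ?val = "\<lambda>i. skolem_val (M i) :: ('f, 'r, 'd) skolem_sym tm \<Rightarrow> 'n"
  define eqv where "eqv = (\<lambda>s t. ae (\<lambda>i. ?val i s = ?val i t))"
  have eqv_refl: "eqv t t" for t
    unfolding eqv_def by (rule ae_all) simp
  have eqv_sym: "eqv s t \<Longrightarrow> eqv t s" for s t
    unfolding eqv_def by (erule ae_mono) simp
  have eqv_trans: "eqv s u" if "eqv s t" "eqv t u" for s t u
  proof -
    have "ae (\<lambda>i. ?val i s = ?val i t \<and> ?val i t = ?val i u)"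
      using that unfolding eqv_def ae_conj by simp
    then show ?thesis
      unfolding eqv_def by (rule ae_mono) simp
  qed
  obtain j :: "('f, 'r, 'd) skolem_sym tm \<Rightarrow> 'm" where j: "inj_on j ?T"
    using room card_of_ordLeq[of ?T "UNIV :: 'm set"] by blast
  \<comment> \<open>\<open>q\<close> realizes the quotient map inside \<open>'m\<close>, by way of canonical representatives, and \<open>c\<close> is a section of it.\<close>
  define rep where "rep = (\<lambda>t. SOME s. s \<in> ?T \<and> eqv t s)"
  have rep: "rep t \<in> ?T \<and> eqv t (rep t)" if "t \<in> ?T" for t
    unfolding rep_def by (rule someI[of _ t]) (simp add: that eqv_refl)
  have rep_eq: "rep s = rep t" if "eqv s t" for s t
  proof -
    have "eqv s = eqv t"
      using that eqv_sym eqv_trans by blast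
    then show ?thesis by (simp add: rep_def)
  qed
  define q where "q = (\<lambda>t. j (rep t))"
  have q_eq: "q s = q t \<longleftrightarrow> eqv s t" if "s \<in> ?T" "t \<in> ?T" for s t
  proof
    assume "q s = q t"
    then have "rep s = rep t"
      using j rep that by (auto simp: q_def dest: inj_onD)
    then show "eqv s t"
      using rep[OF that(1)] rep[OF that(2)] eqv_sym eqv_trans by metis
  qed (simp add: q_def rep_eq)
  define c where "c = inv_into ?T q"
  have cT: "c a \<in> ?T" if "a \<in> q ` ?T" for a
    using that unfolding c_def by (rule inv_into_into)
  have c_q: "eqv (c (q t)) t" if "t \<in> ?T" for t
    using that q_eq[of "c (q t)" t] cT f_inv_into_f[of "q t" q ?T] by (simp add: c_def)
  have c_q_list: "ae (\<lambda>i. map (?val i) (map c (map q ts)) = map (?val i) ts)" if "set ts \<subseteq> ?T" for ts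
  proof -
    have "\<forall>t \<in> set ts. ae (\<lambda>i. ?val i (c (q t)) = ?val i t)"
      using c_q that unfolding eqv_def by blast
    then have "ae (\<lambda>i. \<forall>t \<in> set ts. ?val i (c (q t)) = ?val i t)"
      by (subst ae_ball) (simp_all add: finite_less)
    then show ?thesis
      by (rule ae_mono) simp
  qed
  define N :: "('f, 'r, 'm) struct" where
    "N = \<lparr>univ = q ` ?T,
          fun_interp = (\<lambda>f as. q (Fn (Inl f) (map c as))),
          rel_interp = (\<lambda>r as. ae (\<lambda>i. rel_interp (M i) r (map (?val i) (map c as))))\<rparr>"
  have univ_N: "univ N = q ` ?T"
    by (simp add: N_def)
  have FnT: "Fn (Inl f) ts \<in> ?T" if "f \<in> funs L" "length ts = fun_arity L f" "set ts \<subseteq> ?T" for f ts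
    using that by (intro terms.intros) (auto simp: skolem_language_def)
  have "is_structure L N"
    unfolding is_structure_def
  proof (intro conjI ballI allI impI)
    show "univ N \<noteq> {}"
      using terms.intros(1) by (auto simp: N_def)
  next
    fix f as assume f: "f \<in> funs L" and as: "length as = fun_arity L f \<and> set as \<subseteq> univ N"
    have "set (map c as) \<subseteq> ?T"
      using as cT by (auto simp: N_def)
    then have "Fn (Inl f) (map c as) \<in> ?T"
      using f as by (intro FnT) auto
    then show "fun_interp N f as \<in> univ N"
      by (simp add: N_def)
  qed

  have term_val: "tm_val N (\<lambda>x. q (w x)) s = q (tm_subst w s)"
    if s: "s \<in> terms L" and w: "range w \<subseteq> ?T" for s w
    using s
  proof induction
    case (2 f ss)
    let ?ts = "map (tm_subst w) ss"
    have tsT: "set ?ts \<subseteq> ?T"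
      using 2 tm_subst_terms[OF w] by auto
    have "map (tm_val N (\<lambda>x. q (w x))) ss = map q ?ts"
      using 2 by simp
    then have "tm_val N (\<lambda>x. q (w x)) (Fn f ss) = fun_interp N f (map q ?ts)"
      by (simp only: tm_val.simps)
    then have "tm_val N (\<lambda>x. q (w x)) (Fn f ss) = q (Fn (Inl f) (map c (map q ?ts)))"
      by (simp add: N_def)
    also have "\<dots> = q (Fn (Inl f) ?ts)"
    proof (subst q_eq)
      show "Fn (Inl f) (map c (map q ?ts)) \<in> ?T"
        using 2 tsT cT by (intro FnT) auto
      show "Fn (Inl f) ?ts \<in> ?T"
        using 2 tsT by (intro FnT) auto
      show "eqv (Fn (Inl f) (map c (map q ?ts))) (Fn (Inl f) ?ts)"
        unfolding eqv_def skolem_val_Fn by (rule ae_mono[OF c_q_list[OF tsT]]) metis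
    qed
    finally show ?case by simp
  qed simp

  have val_univ: "?val i t \<in> univ (M i)" if "i \<in> I" "t \<in> ?T" for i t
    using skolem_val_in_univ structures that by blast
  have upd: "(\<lambda>x. q (w x))(y := q t) = (\<lambda>x. q ((w(y := t)) x))"
    "(\<lambda>x. ?val i (w x))(y := ?val i t) = (\<lambda>x. ?val i ((w(y := t)) x))" for w y t i
    by auto
  have Los: "sat N \<phi> (\<lambda>x. q (w x)) \<longleftrightarrow> ae (\<lambda>i. sat (M i) \<phi> (\<lambda>x. ?val i (w x)))"
    if "\<phi> \<in> formulas \<delta> L" "range w \<subseteq> ?T" for \<phi> w
    using that
  proof (induction arbitrary: w)
    case (1 s t)
    then show ?case
      using tm_subst_terms[OF 1(3)]
      by (simp add: term_val q_eq eqv_def skolem_val_subst)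
  next
    case (2 r ss)
    let ?ts = "map (tm_subst w) ss"
    have tsT: "set ?ts \<subseteq> ?T"
      using 2(3) tm_subst_terms[OF 2(4)] by auto
    have "map (tm_val N (\<lambda>x. q (w x))) ss = map q ?ts"
      using 2(3) term_val[OF _ 2(4)] by auto
    then have "sat N (Rel r ss) (\<lambda>x. q (w x)) \<longleftrightarrow> rel_interp N r (map q ?ts)"
      by (simp only: sat.simps)
    also have "\<dots> \<longleftrightarrow>
        ae (\<lambda>i. rel_interp (M i) r (map (?val i) (map c (map q ?ts))))"
      by (simp add: N_def comp_assoc)
    also have "\<dots> \<longleftrightarrow> ae (\<lambda>i. rel_interp (M i) r (map (?val i) (map c (map q ?ts)))
        \<and> map (?val i) (map c (map q ?ts)) = map (?val i) ?ts)"
      using c_q_list[OF tsT] by (subst ae_conj) blast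
    also have "\<dots> \<longleftrightarrow> ae (\<lambda>i. rel_interp (M i) r (map (?val i) ?ts)
        \<and> map (?val i) (map c (map q ?ts)) = map (?val i) ?ts)"
      by (rule ae_cong) metis
    also have "\<dots> \<longleftrightarrow> ae (\<lambda>i. rel_interp (M i) r (map (?val i) ?ts))"
      using c_q_list[OF tsT] by (subst ae_conj) blast
    also have "\<dots> \<longleftrightarrow> ae (\<lambda>i. sat (M i) (Rel r ss) (\<lambda>x. ?val i (w x)))"
      by (simp add: skolem_val_subst comp_def)
    finally show ?case .
  next
    case (3 \<phi>)
    then show ?case by (simp add: ae_not)
  next
    case (4 \<Phi>)
    have small: "|ran \<Phi>| <o \<delta>"
      using ran_less 4(2) by blast
    show ?case
      unfolding sat_Conj_Disj ae_ball[OF small] using 4 by blast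
  next
    case (5 \<Phi>)
    have small: "|ran \<Phi>| <o \<delta>"
      using ran_less 5(2) by blast
    show ?case
      unfolding sat_Conj_Disj ae_bex[OF small] using 5 by blast
  next
    case (6 \<phi> y)
    have wt: "range (w(y := t)) \<subseteq> ?T" if "t \<in> ?T" for t
      using 6(3) that by auto
    let ?s = "skolem_term (Neg \<phi>) y w"
    have "Neg \<phi> \<in> formulas \<delta> L"
      using 6(1) by (rule formulas.intros)
    then have s: "?s \<in> ?T"
      using skolem_term 6(3) by blast
    have "sat N (Forall y \<phi>) (\<lambda>x. q (w x)) \<longleftrightarrow> (\<forall>t \<in> ?T. sat N \<phi> (\<lambda>x. q ((w(y := t)) x)))"
      by (simp add: univ_N upd(1) del: fun_upd_apply)
    also have "\<dots> \<longleftrightarrow> (\<forall>t \<in> ?T. ae (\<lambda>i. sat (M i) \<phi> ((\<lambda>x. ?val i (w x))(y := ?val i t))))"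
      unfolding upd(2) using 6(2) wt by blast
    also have "\<dots> \<longleftrightarrow> ae (\<lambda>i. sat (M i) (Forall y \<phi>) (\<lambda>x. ?val i (w x)))"
    proof (intro iffI ballI)
      assume "\<forall>t \<in> ?T. ae (\<lambda>i. sat (M i) \<phi> ((\<lambda>x. ?val i (w x))(y := ?val i t)))"
      then have "ae (\<lambda>i. sat (M i) \<phi> ((\<lambda>x. ?val i (w x))(y := ?val i ?s)))"
        using s by blast
      then show "ae (\<lambda>i. sat (M i) (Forall y \<phi>) (\<lambda>x. ?val i (w x)))"
        by (rule ae_mono) (simp add: sat_skolem_term_Neg[OF 6(1)] del: fun_upd_apply)
    next
      fix t assume "ae (\<lambda>i. sat (M i) (Forall y \<phi>) (\<lambda>x. ?val i (w x)))" "t \<in> ?T"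
      then show "ae (\<lambda>i. sat (M i) \<phi> ((\<lambda>x. ?val i (w x))(y := ?val i t)))"
        by (elim ae_mono) (simp add: val_univ del: fun_upd_apply)
    qed
    finally show ?case .
  next
    case (7 \<phi> y)
    have wt: "range (w(y := t)) \<subseteq> ?T" if "t \<in> ?T" for t
      using 7(3) that by auto
    let ?s = "skolem_term \<phi> y w"
    have s: "?s \<in> ?T"
      using skolem_term 7 by blast
    have "sat N (Exists y \<phi>) (\<lambda>x. q (w x)) \<longleftrightarrow> (\<exists>t \<in> ?T. sat N \<phi> (\<lambda>x. q ((w(y := t)) x)))"
      by (simp add: univ_N upd(1) del: fun_upd_apply)
    also have "\<dots> \<longleftrightarrow> (\<exists>t \<in> ?T. ae (\<lambda>i. sat (M i) \<phi> ((\<lambda>x. ?val i (w x))(y := ?val i t))))"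
      unfolding upd(2) using 7(2) wt by blast
    also have "\<dots> \<longleftrightarrow> ae (\<lambda>i. sat (M i) (Exists y \<phi>) (\<lambda>x. ?val i (w x)))"
    proof
      assume "\<exists>t \<in> ?T. ae (\<lambda>i. sat (M i) \<phi> ((\<lambda>x. ?val i (w x))(y := ?val i t)))"
      then obtain t where t: "t \<in> ?T" "ae (\<lambda>i. sat (M i) \<phi> ((\<lambda>x. ?val i (w x))(y := ?val i t)))"
        by blast
      from t(2) show "ae (\<lambda>i. sat (M i) (Exists y \<phi>) (\<lambda>x. ?val i (w x)))"
        by (rule ae_mono) (use val_univ t(1) in \<open>auto simp del: fun_upd_apply\<close>)
    next
      assume "ae (\<lambda>i. sat (M i) (Exists y \<phi>) (\<lambda>x. ?val i (w x)))"
      then have "ae (\<lambda>i. sat (M i) \<phi> ((\<lambda>x. ?val i (w x))(y := ?val i ?s)))"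
        by (rule ae_mono) (use sat_skolem_term[of \<phi> \<delta> L _ _ w y] 7(1) in auto)
      with s show "\<exists>t \<in> ?T. ae (\<lambda>i. sat (M i) \<phi> ((\<lambda>x. ?val i (w x))(y := ?val i t)))"
        by blast
    qed
    finally show ?case .
  qed
  show ?thesis
  proof (rule that[of N])
    show "is_structure L N" by fact
  next
    fix \<phi> :: "('f, 'r, 'd) fm" assume \<phi>: "\<phi> \<in> sentences \<delta> L"
    have "models N {\<phi>} \<longleftrightarrow> sat N \<phi> (\<lambda>x. q (Var x))"
      using models_sentence[OF \<open>is_structure L N\<close> \<phi>] .
    also have "\<dots> \<longleftrightarrow> ae (\<lambda>i. sat (M i) \<phi> (\<lambda>x. ?val i (Var x)))"
      using \<phi> by (intro Los) (auto simp: sentences_def intro: terms.intros)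
    also have "\<dots> \<longleftrightarrow> ae (\<lambda>i. models (M i) {\<phi>})"
      using models_sentence[OF structures \<phi>] by (intro ae_cong) blast
    finally show "models N {\<phi>} \<longleftrightarrow> ae (\<lambda>i. models (M i) {\<phi>})" .
  qed
qed

end

section \<open>Compactness from strong compactness\<close>

lemma Card_order_uncountable:
  assumes "uncountable_cardinal r"
  shows "Card_order r" and "infinite (Field r)"
proof -
  show r: "Card_order r"
    using assms by (simp add: uncountable_cardinal_def)
  have "natLeq \<le>o r"
    using assms by (auto simp: uncountable_cardinal_def intro: ordLess_imp_ordLeq)
  then show "infinite (Field r)"
    using r infinite_iff_natLeq_ordLeq card_of_Field_ordIso ordIso_symmetric ordLeq_ordIso_trans by metis
qed

lemma fine_complete_ultrafilter_complete:
  assumes "Card_order \<delta>" "infinite (Field \<delta>)" and "fine_complete_ultrafilter \<delta> \<kappa> lam U"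
  shows "complete_ultrafilter (Pow_less \<kappa> lam) U \<delta>"
  using assms unfolding fine_complete_ultrafilter_def by unfold_locales blast+

theorem proposition24:
  fixes \<delta> :: "'d rel" and \<kappa> :: "'k rel" and lam :: "'l rel"
  assumes "uncountable_cardinal \<delta>" and "uncountable_cardinal \<kappa>" and "uncountable_cardinal lam"
    and "\<delta> \<le>o \<kappa>" and "\<kappa> \<le>o lam"
    and "regularCard \<delta>"
    and "weak_power lam \<delta> =o lam"
    and "strongly_compact_cardinal \<delta> \<kappa> lam"
    and "lam \<le>o |UNIV :: 'm set|"
  shows "compact_cardinal TYPE('f) TYPE('r) TYPE('n) TYPE('m) \<delta> \<kappa> lam"
  unfolding compact_cardinal_def
proof (intro allI impI, elim conjE)
  fix L :: "('f, 'r) language" and T :: "('f, 'r, 'd) fm set"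
  assume L: "|funs L <+> rels L| \<le>o lam" and T: "T \<subseteq> sentences \<delta> L"
    and small_models: "\<forall>T0 \<subseteq> T. |T0| <o \<kappa> \<longrightarrow> has_model TYPE('n) L T0"
  let ?A = "Field lam" and ?I = "Pow_less \<kappa> lam"
  note \<delta> = Card_order_uncountable[OF assms(1)] and lam = Card_order_uncountable[OF assms(3)]
  have A: "|?A| =o lam"
    using lam(1) by (rule card_of_Field_ordIso)
  have le_A: "X \<le>o |?A|" if "X \<le>o lam" for X :: "'x rel"
    using that A ordIso_symmetric ordLeq_ordIso_trans by blast
  have power: "|SIGMA a : Field \<delta>. Func (underS \<delta> a) ?A| \<le>o |?A|"
    using assms(7) by (intro le_A) (simp add: weak_power_def ordIso_imp_ordLeq)
  have funs: "|funs L| \<le>o |?A|" and rels: "|rels L| \<le>o |?A|"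
    using L by (auto intro!: le_A intro: ordLeq_transitive card_of_Plus1 card_of_Plus2)
  note size = \<delta> assms(6) lam(2) power funs rels
  obtain U where U: "fine_complete_ultrafilter \<delta> \<kappa> lam U"
    using assms(8) unfolding strongly_compact_cardinal_def by blast
  interpret complete_ultrafilter ?I U \<delta>
    using \<delta> U by (rule fine_complete_ultrafilter_complete)

  have "|T| \<le>o |formulas \<delta> L|"
    using T by (intro card_of_mono1) (auto simp: sentences_def)
  then have "|T| \<le>o |?A|"
    using card_formulas[OF size] by (rule ordLeq_transitive)
  then obtain g where g: "inj_on g T" "g ` T \<subseteq> ?A"
    using card_of_ordLeq[of T ?A] by blast
  have "\<exists>M :: ('f, 'r, 'n) struct. is_structure L M \<and> models M {\<phi> \<in> T. g \<phi> \<in> x}" if "x \<in> ?I" for x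
  proof -
    \<comment> \<open>The subtheory at \<open>x\<close> is small because \<open>g\<close> embeds it into \<open>x\<close>.\<close>
    have "|{\<phi> \<in> T. g \<phi> \<in> x}| \<le>o |x|"
      using g(1) by (intro card_of_ordLeqI[of g]) (auto intro: inj_on_subset)
    then have "|{\<phi> \<in> T. g \<phi> \<in> x}| <o \<kappa>"
      using that unfolding Pow_less_def by (auto intro: ordLeq_ordLess_trans)
    then have "has_model TYPE('n) L {\<phi> \<in> T. g \<phi> \<in> x}"
      using small_models by simp
    then show ?thesis
      unfolding has_model_def .
  qed
  then have "\<forall>x \<in> ?I. \<exists>M :: ('f, 'r, 'n) struct. is_structure L M \<and> models M {\<phi> \<in> T. g \<phi> \<in> x}"
    by blast
  from bchoice[OF this] obtain M :: "'l set \<Rightarrow> ('f, 'r, 'n) struct"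
    where M: "\<And>x. x \<in> ?I \<Longrightarrow> is_structure L (M x)"
      and M_sat: "\<And>x. x \<in> ?I \<Longrightarrow> models (M x) {\<phi> \<in> T. g \<phi> \<in> x}"
    by blast
  have "|terms (skolem_language \<delta> L)| \<le>o |UNIV :: 'm set|"
    by (rule ordLeq_transitive[OF card_skolem_terms[OF size] ordIso_ordLeq_trans[OF A assms(9)]])
  then obtain N :: "('f, 'r, 'm) struct" where N: "is_structure L N"
    and Los: "\<And>\<phi>. \<phi> \<in> sentences \<delta> L \<Longrightarrow> models N {\<phi>} \<longleftrightarrow> ae (\<lambda>x. models (M x) {\<phi>})"
    using Los_Skolem_terms[of L M, OF M] by blast
  have "models N {\<phi>}" if "\<phi> \<in> T" for \<phi>
  proof -
    have "g \<phi> \<in> ?A"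
      using g(2) that by blast
    \<comment> \<open>This is fineness at the ordinal \<open>g \<phi>\<close>.\<close>
    then have "ae (\<lambda>x. g \<phi> \<in> x)"
      using U unfolding fine_complete_ultrafilter_def ae_def by blast
    then have "ae (\<lambda>x. models (M x) {\<phi>})"
      by (rule ae_mono) (use M_sat that in \<open>auto simp: models_def\<close>)
    then show ?thesis
      using Los T that by blast
  qed
  then have "models N T"
    by (auto simp: models_def)
  with N show "has_model TYPE('m) L T"
    unfolding has_model_def by blast
qed

end
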